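(* There exist absolute constants $\gamma<1$ and $k_0\ge 1$ such that the following holds. Let $p\in(0,1/32]$, let $k\ge k_0$ and $n\ge k$ be integers, and let $V\subseteq \mathbf{Q}^n$ be a linear subspace of dimension $\dim(V)=n-k$. Then for random vectors $X\sim \mu_{1/2}^{\otimes n}$ and $Y\sim\mu_p^{\otimes n}$ we have $$\sup_{t\in\mathbf{Q}^n}\mathbf{P}[X+t\in V]\le \gamma^{k}\cdot \mathbf{P}[Y\in V].$$
   Context: For $p\in[0,1/2]$, $\mu_p$ denotes the probability distribution on $\{-1,0,1\}$ which takes the values $1$ and $-1$ each with probability $p$, and the value $0$ with probability $1-2p$ (in particular, $\mu_{1/2}$ is the uniform distribution on $\{\pm1\}$). $\mu_p^{\otimes n}$ denotes the distribution of a random vector with $n$ independent coordinates, each distributed according to $\mu_p$. The constants $\gamma$ and $k_0$ do not depend on $p$, $k$, $n$ or $V$. *)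

theory Defs
  imports "HOL-Probability.Product_PMF" "Jordan_Normal_Form.VS_Connect"
begin

definition mu :: "real \<Rightarrow> rat pmf" where
  "mu p = pmf_of_list [(1, p), (-1, p), (0, 1 - 2 * p)]"

text \<open>Outside \<open>0 \<le> p \<le> 1/2\<close> the weights do not form a probability distribution and
  \<^const>\<open>mu\<close> is unspecified; inside that range it has the intended point masses.\<close>

lemma pmf_mu:
  assumes "0 \<le> p" "p \<le> 1/2"
  shows "pmf (mu p) x = (if x = 1 \<or> x = -1 then p else if x = 0 then 1 - 2 * p else 0)"
proof -
  have "pmf_of_list_wf [(1::rat, p), (-1, p), (0, 1 - 2 * p)]"
    using assms by (auto intro!: pmf_of_list_wfI)
  then show ?thesis
    by (simp add: mu_def pmf_pmf_of_list)
qed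

text \<open>Coordinates are indexed by \<open>0, \<dots>, n - 1\<close>. The default value \<open>0\<close> that \<^const>\<open>Pi_pmf\<close>
  assigns outside the index set is discarded when the function is turned into a vector.\<close>

definition mu_vec :: "real \<Rightarrow> nat \<Rightarrow> rat Matrix.vec pmf" where
  "mu_vec p n = map_pmf (Matrix.vec n) (Pi_pmf {..<n} 0 (\<lambda>_. mu p))"

abbreviation lin_subspace :: "nat \<Rightarrow> rat Matrix.vec set \<Rightarrow> bool" where
  "lin_subspace n V \<equiv> VectorSpace.subspace class_ring V (module_vec TYPE(rat) n)"

abbreviation subspace_dim :: "nat \<Rightarrow> rat Matrix.vec set \<Rightarrow> nat" where
  "subspace_dim n V \<equiv> vectorspace.dim class_ring ((module_vec TYPE(rat) n)\<lparr>carrier := V\<rparr>)"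

end

theory Submission
  imports Defs
begin

text \<open>Gaussian elimination over \<open>\<rat>\<close> in which every pivot has least 2-adic valuation describes
  \<open>V\<close> by \<open>k\<close> integer equations with an odd pivot entry each. By Fourier inversion modulo a
  large \<open>4 N\<close>, \<open>P[X + t \<in> V]\<close> is at most the average over frequencies of a product of factors
  \<open>\<bar>cos y\<^sub>j\<bar>\<close>, whereas \<open>P[Y \<in> V]\<close> is the average of the product of
  \<open>\<phi>(4 y\<^sub>j) = 1 - 2 p + 2 p cos (4 y\<^sub>j)\<close>. Every factor satisfies \<open>\<bar>cos y\<bar> \<le> \<phi>(4 y)\<close>, and
  \<open>\<phi>(4 y)\<close> does not change under the shifts of \<open>y\<close> by multiples of \<open>\<pi>/2\<close>. Oddness of the
  pivots makes the shifts at the \<open>k\<close> pivots independent, and averaging \<open>\<bar>cos y\<bar>\<close> over the four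
  shifts gives at most \<open>1/\<surd>2 < 49/64 \<le> 7/8 \<phi>(4 y)\<close>. Hence \<open>\<gamma> = 7/8\<close> works.\<close>

subsection \<open>Integer equations with odd pivots\<close>

text \<open>The integers localised at 2, that is, the rationals of nonnegative 2-adic valuation. Any
  representing fraction with odd denominator counts, reduced or not, so closure under products and
  differences is immediate.\<close>

definition odd_denom :: "rat \<Rightarrow> bool" where
  "odd_denom q \<longleftrightarrow> (\<exists>a b::int. odd b \<and> q = of_int a / of_int b)"

lemma odd_denom_0: "odd_denom 0" and odd_denom_1: "odd_denom 1"
  unfolding odd_denom_def by (rule exI[of _ 0], rule exI[of _ 1], simp, rule exI[of _ 1], rule exI[of _ 1], simp)

lemma odd_denom_mult:
  assumes "odd_denom p" "odd_denom q"
  shows "odd_denom (p * q)"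
proof -
  obtain a b c d :: int where "odd b" "p = of_int a / of_int b" "odd d" "q = of_int c / of_int d"
    using assms unfolding odd_denom_def by blast
  then have "odd (b * d) \<and> p * q = of_int (a * c) / of_int (b * d)"
    by simp
  then show ?thesis
    unfolding odd_denom_def by blast
qed

lemma odd_denom_diff:
  assumes "odd_denom p" "odd_denom q"
  shows "odd_denom (p - q)"
proof -
  obtain a b c d :: int where *: "odd b" "p = of_int a / of_int b" "odd d" "q = of_int c / of_int d"
    using assms unfolding odd_denom_def by blast
  have "b \<noteq> 0" "d \<noteq> 0"
    using * by auto
  then have "odd (b * d) \<and> p - q = of_int (a * d - c * b) / of_int (b * d)"
    using * by (simp add: diff_frac_eq)
  then show ?thesis
    unfolding odd_denom_def by blast
qed

text \<open>In lowest terms, numerator and denominator are not both even: the localisation is a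
  valuation ring. Divisibility is therefore total, so a best pivot exists.\<close>

lemma odd_denom_or_inverse: "odd_denom q \<or> odd_denom (inverse q)"
proof -
  obtain a b where ab: "quotient_of q = (a, b)"
    by (cases "quotient_of q")
  have "coprime a b" and q: "q = of_int a / of_int b"
    using ab quotient_of_coprime quotient_of_div by auto
  then have "odd a \<or> odd b"
    by (metis coprime_common_divisor odd_one)
  moreover have "inverse q = of_int b / of_int a"
    by (simp add: q)
  ultimately show ?thesis
    using q unfolding odd_denom_def by blast
qed

text \<open>The pivot is an element of least 2-adic valuation.\<close>

lemma exists_odd_denom_pivot:
  fixes f :: "'i \<Rightarrow> rat"
  assumes "finite S" "i \<in> S" "f i \<noteq> 0"
  shows "\<exists>l\<in>S. f l \<noteq> 0 \<and> (\<forall>i\<in>S. odd_denom (f i / f l))"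
  using assms
proof (induction S arbitrary: i rule: finite_induct)
  case (insert m S)
  show ?case
  proof (cases "\<exists>j\<in>S. f j \<noteq> 0")
    case True
    then obtain l where l: "l \<in> S" "f l \<noteq> 0" "\<And>i. i \<in> S \<Longrightarrow> odd_denom (f i / f l)"
      using insert.IH by blast
    show ?thesis
    proof (cases "odd_denom (f m / f l)")
      case True
      then show ?thesis using l by blast
    next
      \<comment> \<open>Here \<open>f m\<close> has strictly smaller valuation than
        \<open>f l\<close>, so \<open>m\<close> takes over as pivot; quotients by \<open>f m\<close>
        are quotients by \<open>f l\<close> times \<open>f l / f m\<close>.\<close>
      case False
      then have m: "f m \<noteq> 0"
        using odd_denom_0 by auto
      have "odd_denom (f l / f m)"
        using False odd_denom_or_inverse[of "f m / f l"] by simp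
      then have "odd_denom (f i / f m)" if "i \<in> S" for i
        using odd_denom_mult[OF l(3)[OF that], of "f l / f m"] l(2) by simp
      then show ?thesis
        using m odd_denom_1 by (intro bexI[of _ m]) auto
    qed
  next
    case False
    then show ?thesis
      using insert.prems odd_denom_0 odd_denom_1 by (intro bexI[of _ m]) auto
  qed
qed simp

text \<open>The product of the individual odd denominators works and is again odd. Scaling an
  equation by it turns a pivot 1 into an odd integer.\<close>

lemma odd_common_denominator:
  assumes "finite J" "\<And>j. j \<in> J \<Longrightarrow> odd_denom (f j)"
  shows "\<exists>D::int. odd D \<and> (\<forall>j\<in>J. of_int D * f j \<in> \<int>)"
  using assms
proof (induction J rule: finite_induct)
  case empty
  then show ?case by (intro exI[of _ 1]) simp
next
  case (insert m J)
  then obtain D :: int where D: "odd D" "\<forall>j\<in>J. of_int D * f j \<in> \<int>"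
    by auto
  obtain a b :: int where b: "odd b" "f m = of_int a / of_int b"
    using insert.prems unfolding odd_denom_def by blast
  have "of_int (D * b) * f m = of_int (D * a)"
    using b by auto
  then have "of_int (D * b) * f m \<in> \<int>"
    by (simp only: Ints_of_int)
  moreover have "of_int (D * b) * f j \<in> \<int>" if "j \<in> J" for j
  proof -
    have "of_int b * (of_int D * f j) \<in> \<int>"
      using D(2) that Ints_mult[OF Ints_of_int] by blast
    moreover have "of_int b * (of_int D * f j) = of_int (D * b) * f j"
      by simp
    ultimately show ?thesis by (simp only:)
  qed
  ultimately show ?case
    using D(1) b(1) by (intro exI[of _ "D * b"]) simp
qed

lemma sum_minus_scaled:
  fixes a b f :: "'i \<Rightarrow> 'a::comm_ring"
  shows "(\<Sum>j\<in>J. (a j - c * b j) * f j) = (\<Sum>j\<in>J. a j * f j) - c * (\<Sum>j\<in>J. b j * f j)"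
  by (simp add: left_diff_distrib sum_subtractf sum_distrib_left mult.assoc)

section \<open>Bases and equations of subspaces\<close>

context vec_space
begin

text \<open>The span of \<open>insert v U\<close> is the sum of \<open>span U\<close> and the line
  through \<open>v\<close>. Once \<open>span U\<close> is given by equations, membership becomes
  solvability in the single unknown \<open>c\<close>, which is what one elimination step
  uses.\<close>

lemma in_span_insert_iff:
  assumes U: "U \<subseteq> carrier_vec n" and v: "v \<in> carrier_vec n" and x: "x \<in> carrier_vec n"
  shows "x \<in> span (insert v U) \<longleftrightarrow> (\<exists>c. x - c \<cdot>\<^sub>v v \<in> span U)"
proof
  assume "x \<in> span (insert v U)"
  then have "x \<in> submodule_sum (span U) (span {v})"
    using span_union_is_sum[of U "{v}"] U v by simp
  then obtain u w where uw: "u \<in> span U" "w \<in> span {v}" "x = u + w"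
    unfolding submodule_sum_def by auto
  obtain c where c: "w = c \<cdot>\<^sub>v v"
  proof -
    have "span {v} = {lincomb a {v} |a. a \<in> {v} \<rightarrow> UNIV}"
      using finite_span[of "{v}"] v by simp
    then obtain a where "w = lincomb a {v}"
      using uw by auto
    then have "w = a v \<cdot>\<^sub>v v"
      using v by (simp add: lincomb_def)
    then show ?thesis using that by blast
  qed
  have "u \<in> carrier_vec n"
    using span_closed[OF U] uw by simp
  then have "x - c \<cdot>\<^sub>v v = u"
    unfolding uw c using v by auto
  then show "\<exists>c. x - c \<cdot>\<^sub>v v \<in> span U"
    using uw by blast
next
  assume "\<exists>c. x - c \<cdot>\<^sub>v v \<in> span U"
  then obtain c where c: "x - c \<cdot>\<^sub>v v \<in> span U" by blast
  have ins: "insert v U \<subseteq> carrier_vec n" using U v by simp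
  have "x - c \<cdot>\<^sub>v v \<in> span (insert v U)"
    using c span_is_monotone[of U "insert v U"] by auto
  moreover have "c \<cdot>\<^sub>v v \<in> span (insert v U)"
    using smult_in_span[OF ins] span_mem[OF ins] by auto
  ultimately have "(x - c \<cdot>\<^sub>v v) + c \<cdot>\<^sub>v v \<in> span (insert v U)"
    using span_add1[OF ins] by simp
  moreover have "(x - c \<cdot>\<^sub>v v) + c \<cdot>\<^sub>v v = x"
    using x v by auto
  ultimately show "x \<in> span (insert v U)" by simp
qed

text \<open>A maximal independent subset of \<open>W\<close> exists because independent sets have at
  most \<open>n\<close> elements; by maximality every further vector of \<open>W\<close> lies in its
  span. Independence and span are the same inside \<open>W\<close> as in the whole space, so its
  cardinality is the dimension.\<close>

lemma subspace_basis:
  assumes "VectorSpace.subspace class_ring W V"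
  obtains B where "finite B" "B \<subseteq> carrier_vec n" "lin_indpt B" "span B = W"
    "vectorspace.dim class_ring (V\<lparr>carrier := W\<rparr>) = card B"
proof -
  have sub: "submodule class_ring W V"
    using assms unfolding VectorSpace.subspace_def by simp
  have W: "W \<subseteq> carrier_vec n"
    using sub unfolding submodule_def by simp
  have "\<exists>A. finite A \<and> maximal A (\<lambda>A. A \<subseteq> W \<and> lin_indpt A)"
  proof (rule maximal_exists)
    fix A assume "A \<subseteq> W \<and> lin_indpt A"
    then show "finite A \<and> card A \<le> n"
      using li_le_dim[of A] W dim_is_n fin_dim by auto
  next
    show "{} \<subseteq> W \<and> lin_indpt {}"
      by (auto simp: lin_dep_def)
  qed
  then obtain B where "finite B" and "maximal B (\<lambda>A. A \<subseteq> W \<and> lin_indpt A)"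
    by (elim exE conjE)
  then have B: "finite B" "B \<subseteq> W" "lin_indpt B"
    and max: "\<And>C. B \<subseteq> C \<Longrightarrow> C \<subseteq> W \<Longrightarrow> lin_indpt C \<Longrightarrow> C = B"
    unfolding maximal_def by simp_all
  have BV: "B \<subseteq> carrier_vec n"
    using B W by auto
  have "span B = W"
  proof
    show "span B \<subseteq> W"
      using span_is_subset[OF B(2) sub] .
    show "W \<subseteq> span B"
    proof
      fix w assume w: "w \<in> W"
      show "w \<in> span B"
      proof (cases "w \<in> B")
        case True
        then show ?thesis using span_mem BV by simp
      next
        case False
        then have "lin_dep (B \<union> {w})"
          using max[of "B \<union> {w}"] w B(2) by auto
        then show ?thesis
          using lin_dep_iff_in_span[of B w] BV B(3) w W False by auto
      qed
    qed
  qed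
  interpret W: vectorspace class_ring "V\<lparr>carrier := W\<rparr>"
    by (rule subspace_is_vs[OF assms])
  have "W.basis B"
    unfolding W.basis_def using span_li_not_depend[OF B(2) sub] B \<open>span B = W\<close> by simp
  then show ?thesis
    using that W.dim_basis B(1) BV B(3) \<open>span B = W\<close> by metis
qed

end

text \<open>\<open>S\<close> indexes both the equations and their pivot columns: equation
  \<open>i\<close> has its pivot in column \<open>i\<close>. The submatrix on the pivot columns is
  the identity, so \<open>card S\<close> is the codimension.\<close>

definition pivoted_kernel :: "nat \<Rightarrow> rat Matrix.vec set \<Rightarrow> nat set \<Rightarrow> (nat \<Rightarrow> nat \<Rightarrow> rat) \<Rightarrow> bool" where
  "pivoted_kernel n W S r \<longleftrightarrow> S \<subseteq> {..<n} \<and> (\<forall>i\<in>S. \<forall>j<n. odd_denom (r i j)) \<and>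
     (\<forall>i\<in>S. \<forall>j\<in>S. r i j = (if i = j then 1 else 0)) \<and>
     W = {x \<in> carrier_vec n. \<forall>i\<in>S. (\<Sum>j<n. r i j * vec_index x j) = 0}"

text \<open>A pivoted Gaussian elimination: the pivots are chosen of least 2-adic valuation, which keeps
  all denominators odd.\<close>

lemma span_eq_kernel_odd_denom:
  assumes "finite B" "B \<subseteq> carrier_vec n" "\<not> module.lin_dep class_ring (module_vec TYPE(rat) n) B"
  shows "\<exists>S r. card S + card B = n \<and>
    pivoted_kernel n (LinearCombinations.module.span class_ring (module_vec TYPE(rat) n) B) S r"
proof -
  interpret vec_space "TYPE(rat)" n .
  show ?thesis
    using assms
  proof (induction B rule: finite_induct)
    case empty
    let ?r = "\<lambda>i j. (if i = j then 1 else 0) :: rat"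
    have "(\<Sum>j<n. ?r i j * vec_index x j) = vec_index x i" if "i < n" for i and x :: "rat Matrix.vec"
      using that sum.delta'[of "{..<n}" i "\<lambda>j. vec_index x j"]
      by (simp add: if_distrib[of "\<lambda>c. c * _"] cong: if_cong)
    then have "span {} = {x \<in> carrier_vec n. \<forall>i\<in>{..<n}. (\<Sum>j<n. ?r i j * vec_index x j) = 0}"
      using span_empty by auto
    then have "pivoted_kernel n (span {}) {..<n} ?r"
      unfolding pivoted_kernel_def by (auto simp: odd_denom_0 odd_denom_1)
    then show ?case by (intro exI[of _ "{..<n}"] exI[of _ ?r]) simp
  next
    case (insert v B)
    have carr: "v \<in> carrier_vec n" "B \<subseteq> carrier_vec n" and li: "lin_indpt B"
      using insert.prems subset_li_is_li[of "insert v B" B] by auto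
    obtain S r where card: "card S + card B = n" and ker: "pivoted_kernel n (span B) S r"
      using insert.IH[OF carr(2) li] by (elim exE conjE)
    have S: "S \<subseteq> {..<n}"
      and odd: "\<And>i j. i \<in> S \<Longrightarrow> j < n \<Longrightarrow> odd_denom (r i j)"
      and id: "\<And>i j. i \<in> S \<Longrightarrow> j \<in> S \<Longrightarrow> r i j = (if i = j then 1 else 0)"
      and span: "span B = {x \<in> carrier_vec n. \<forall>i\<in>S. (\<Sum>j<n. r i j * vec_index x j) = 0}"
      using ker unfolding pivoted_kernel_def by (elim conjE; simp)+
    define R where "R i x = (\<Sum>j<n. r i j * vec_index x j)" for i x
    have "finite S" using S finite_subset by blast
    have "v \<notin> span B"
      using lin_dep_iff_in_span[of B v] insert.prems insert.hyps carr li by simp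
    then obtain i where "i \<in> S" "R i v \<noteq> 0"
      using span carr unfolding R_def by blast
    then obtain l where l: "l \<in> S" "R l v \<noteq> 0" "\<And>i. i \<in> S \<Longrightarrow> odd_denom (R i v / R l v)"
      using exists_odd_denom_pivot[OF \<open>finite S\<close>, of i "\<lambda>i. R i v"] by blast
    \<comment> \<open>Equation \<open>l\<close> forces the coefficient of \<open>v\<close> to be
      \<open>R l x / R l v\<close>; substituting it into the other equations is this row operation.
      Its multiplier has odd denominator by the choice of \<open>l\<close>.\<close>
    define r' where "r' i j = r i j - (R i v / R l v) * r l j" for i j
    have R': "(\<Sum>j<n. r' i j * vec_index x j) = R i x - (R i v / R l v) * R l x" for i x
      unfolding r'_def R_def by (rule sum_minus_scaled)
    have Rdiff: "R i (x - c \<cdot>\<^sub>v v) = R i x - c * R i v" if "x \<in> carrier_vec n" for i x c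
    proof -
      have "R i (x - c \<cdot>\<^sub>v v) = (\<Sum>j<n. (vec_index x j - c * vec_index v j) * r i j)"
        unfolding R_def using that carr(1) by (intro sum.cong) auto
      then show ?thesis
        unfolding sum_minus_scaled R_def by (simp add: mult.commute)
    qed
    have "span (insert v B) = {x \<in> carrier_vec n. \<forall>i\<in>S - {l}. (\<Sum>j<n. r' i j * vec_index x j) = 0}"
      (is "_ = ?K")
    proof (rule Set.set_eqI)
      fix x
      show "x \<in> span (insert v B) \<longleftrightarrow> x \<in> ?K"
      proof (cases "x \<in> carrier_vec n")
        case True
        have "x \<in> span (insert v B) \<longleftrightarrow> (\<exists>c. x - c \<cdot>\<^sub>v v \<in> span B)"
          using in_span_insert_iff carr True by simp
        also have "\<dots> \<longleftrightarrow> (\<exists>c. \<forall>i\<in>S. R i x - c * R i v = 0)"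
          using Rdiff[OF True] True carr(1) unfolding span R_def[symmetric] by simp
        also have "\<dots> \<longleftrightarrow> (\<forall>i\<in>S. R i x - (R l x / R l v) * R i v = 0)"
        proof
          assume "\<exists>c. \<forall>i\<in>S. R i x - c * R i v = 0"
          then obtain c where c: "\<forall>i\<in>S. R i x - c * R i v = 0" by blast
          then have "R l x - c * R l v = 0" using l by blast
          then have "c = R l x / R l v" using l by (simp add: field_simps)
          then show "\<forall>i\<in>S. R i x - (R l x / R l v) * R i v = 0"
            using c by simp
        qed blast
        also have "\<dots> \<longleftrightarrow> (\<forall>i\<in>S - {l}. R i x - (R i v / R l v) * R l x = 0)"
          using l(2) by (auto simp: mult.commute)
        also have "\<dots> \<longleftrightarrow> x \<in> ?K"
          using True by (simp only: R' mem_Collect_eq simp_thms)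
        finally show ?thesis .
      next
        case False
        then show ?thesis
          using span_closed[of "insert v B" x] insert.prems by auto
      qed
    qed
    moreover have card': "card (S - {l}) + card (insert v B) = n"
      using card insert.hyps l \<open>finite S\<close> card_Suc_Diff1[OF \<open>finite S\<close> l(1)] by simp
    moreover have "odd_denom (r' i j)" if "i \<in> S - {l}" "j < n" for i j
      unfolding r'_def using that odd l by (intro odd_denom_diff odd_denom_mult) auto
    \<comment> \<open>For \<open>j\<close> in \<open>S - {l}\<close> the entry \<open>r l j\<close>
      is 0, so the identity block survives.\<close>
    moreover have "r' i j = (if i = j then 1 else 0)" if "i \<in> S - {l}" "j \<in> S - {l}" for i j
      unfolding r'_def using that id l by auto
    ultimately have "pivoted_kernel n (span (insert v B)) (S - {l}) r'"
      unfolding pivoted_kernel_def using S by blast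
    then show ?case
      using card' by blast
  qed
qed

text \<open>Row \<open>i\<close> is scaled by an odd common denominator \<open>D i\<close>. As
  \<open>D i\<close> is nonzero the solution set is unchanged, and the pivot 1 becomes the odd entry
  \<open>D i\<close>.\<close>

lemma subspace_eq_integer_kernel:
  assumes "lin_subspace n W" "subspace_dim n W = n - k" "k \<le> n"
  obtains S and c :: "nat \<Rightarrow> nat \<Rightarrow> int"
  where "S \<subseteq> {..<n}" "card S = k" "\<And>i. i \<in> S \<Longrightarrow> odd (c i i)"
    "\<And>i j. i \<in> S \<Longrightarrow> j \<in> S \<Longrightarrow> i \<noteq> j \<Longrightarrow> c i j = 0"
    "W = {x \<in> carrier_vec n. \<forall>i\<in>S. (\<Sum>j<n. of_int (c i j) * vec_index x j) = 0}"
proof -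
  interpret vec_space "TYPE(rat)" n .
  obtain B where B: "finite B" "B \<subseteq> carrier_vec n" "lin_indpt B" "span B = W" "card B = n - k"
    using subspace_basis[OF assms(1)] assms(2) by metis
  obtain S r where card: "card S + card B = n" and ker: "pivoted_kernel n W S r"
    using span_eq_kernel_odd_denom[OF B(1-3)] unfolding B(4) by (elim exE conjE)
  have S: "S \<subseteq> {..<n}"
    and odd: "\<And>i j. i \<in> S \<Longrightarrow> j < n \<Longrightarrow> odd_denom (r i j)"
    and id: "\<And>i j. i \<in> S \<Longrightarrow> j \<in> S \<Longrightarrow> r i j = (if i = j then 1 else 0)"
    and W: "W = {x \<in> carrier_vec n. \<forall>i\<in>S. (\<Sum>j<n. r i j * vec_index x j) = 0}"
    using ker unfolding pivoted_kernel_def by (elim conjE; simp)+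
  have "\<exists>D::int. odd D \<and> (\<forall>j\<in>{..<n}. of_int D * r i j \<in> \<int>)" if "i \<in> S" for i
    using that odd by (intro odd_common_denominator) auto
  then obtain D :: "nat \<Rightarrow> int" where D: "\<And>i. i \<in> S \<Longrightarrow> odd (D i)"
    "\<And>i j. i \<in> S \<Longrightarrow> j < n \<Longrightarrow> of_int (D i) * r i j \<in> \<int>"
    by (metis lessThan_iff)
  define c where "c i j = \<lfloor>of_int (D i) * r i j\<rfloor>" for i j
  have c: "of_int (c i j) = of_int (D i) * r i j" if "i \<in> S" "j < n" for i j
    using D(2)[OF that] unfolding c_def by (simp add: of_int_floor_cancel)
  have sum: "(\<Sum>j<n. of_int (c i j) * vec_index x j) = of_int (D i) * (\<Sum>j<n. r i j * vec_index x j)"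
    if "i \<in> S" for i x
    unfolding sum_distrib_left using that by (intro sum.cong) (auto simp: c mult.assoc)
  show ?thesis
  proof (rule that[of S c])
    show "S \<subseteq> {..<n}" by fact
    show "card S = k" using card B assms by simp
    show "odd (c i i)" if "i \<in> S" for i
      unfolding c_def using that id D by simp
    show "c i j = 0" if "i \<in> S" "j \<in> S" "i \<noteq> j" for i j
      unfolding c_def using that id by simp
    have "D i \<noteq> 0" if "i \<in> S" for i
      using D(1)[OF that] by auto
    then show "W = {x \<in> carrier_vec n. \<forall>i\<in>S. (\<Sum>j<n. of_int (c i j) * vec_index x j) = 0}"
      unfolding W by (auto simp: sum)
  qed
qed

subsection \<open>Fourier inversion\<close>

lemma cis_sum: "cis (sum f A) = (\<Prod>x\<in>A. cis (f x))"
  by (induction A rule: infinite_finite_induct) (simp_all add: cis_mult[symmetric])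

text \<open>Orthogonality of the characters modulo \<open>M\<close>: the terms are the powers of one
  \<open>M\<close>-th root of unity, whose geometric sum vanishes unless the root is 1.\<close>

lemma sum_cis_multiples:
  fixes M :: nat and w :: int
  assumes "M > 0"
  shows "(\<Sum>a<M. cis (2 * pi / M * (real a * of_int w))) = (if int M dvd w then of_nat M else 0)"
proof -
  define q where "q = cis (2 * pi / M * of_int w)"
  have pow: "cis (2 * pi / M * (real a * of_int w)) = q ^ a" for a
    unfolding q_def Complex.DeMoivre by (intro arg_cong[where f = cis]) (simp add: algebra_simps)
  have "real M * (2 * pi / M * of_int w) = 2 * pi * of_int w"
    using assms by simp
  then have "q ^ M = cis (2 * pi * of_int w)"
    unfolding q_def Complex.DeMoivre by (simp only:)
  then have qM: "q ^ M = 1" by simp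
  have q1: "q = 1 \<longleftrightarrow> int M dvd w"
  proof
    assume "q = 1"
    then have "cos (2 * pi / M * of_int w) = 1"
      unfolding q_def by (simp add: complex_eq_iff)
    then obtain m :: int where "2 * pi / M * of_int w = of_int m * 2 * pi"
      unfolding cos_one_2pi_int by blast
    then have "real_of_int w = of_int (int M * m)"
      using assms by (simp add: field_simps)
    then show "int M dvd w"
      by (simp only: of_int_eq_iff) simp
  next
    assume "int M dvd w"
    then obtain m where "w = int M * m" by blast
    then have "2 * pi / M * of_int w = 2 * pi * of_int m"
      using assms by simp
    then show "q = 1" unfolding q_def by simp
  qed
  show ?thesis
  proof (cases "int M dvd w")
    case True
    then have "q = 1" using q1 by simp
    then show ?thesis unfolding pow using True by simp
  next
    case False
    then have "q \<noteq> 1" using q1 by simp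
    then show ?thesis unfolding pow using geometric_sum[of q M] qM False by simp
  qed
qed

text \<open>The characteristic function of \<open>mu p\<close>; it is real because the distribution
  is symmetric, and it is the cosine at \<open>p\<close> = 1/2.\<close>

definition lazy_char :: "real \<Rightarrow> real \<Rightarrow> real" where
  "lazy_char p y = 1 - 2 * p + 2 * p * cos y"

lemma set_pmf_mu_subset:
  assumes "0 \<le> p" "p \<le> 1/2"
  shows "set_pmf (mu p) \<subseteq> {1, -1, 0}"
  using assms by (auto simp: set_pmf_iff pmf_mu split: if_splits)

lemma expectation_mu_cis:
  assumes "0 \<le> p" "p \<le> 1/2"
  shows "measure_pmf.expectation (mu p) (\<lambda>x. cis (\<alpha> * real_of_rat x)) = of_real (lazy_char p \<alpha>)"
proof -
  have "measure_pmf.expectation (mu p) (\<lambda>x. cis (\<alpha> * real_of_rat x)) =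
      (\<Sum>x\<in>{1, -1, 0}. pmf (mu p) x *\<^sub>R cis (\<alpha> * real_of_rat x))"
    using set_pmf_mu_subset[OF assms] by (intro integral_measure_pmf) auto
  also have "\<dots> = of_real (lazy_char p \<alpha>)"
    by (simp add: pmf_mu[OF assms] lazy_char_def complex_eq_iff algebra_simps)
  finally show ?thesis .
qed

lemma expectation_prod_Pi_pmf_complex:
  fixes f :: "'i \<Rightarrow> 'a \<Rightarrow> complex"
  assumes "finite J" "\<And>j. j \<in> J \<Longrightarrow> finite (set_pmf (q j))"
  shows "measure_pmf.expectation (Pi_pmf J d q) (\<lambda>x. \<Prod>j\<in>J. f j (x j)) =
    (\<Prod>j\<in>J. measure_pmf.expectation (q j) (f j))"
proof -
  have comp: "map_pmf (\<lambda>x. x j) (Pi_pmf J d q) = q j" if "j \<in> J" for j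
    using Pi_pmf_component[OF assms(1), of j d q] that by simp
  have fin: "integrable (measure_pmf (Pi_pmf J d q)) (\<lambda>x. f j (x j))" if "j \<in> J" for j
  proof -
    have "integrable (measure_pmf (map_pmf (\<lambda>x. x j) (Pi_pmf J d q))) (f j)"
      unfolding comp[OF that] using assms(2)[OF that] by (rule integrable_measure_pmf_finite)
    then show ?thesis by simp
  qed
  have "prob_space.indep_vars (measure_pmf (Pi_pmf J d q)) (\<lambda>_. borel) (\<lambda>j x. f j (x j)) J"
    by (rule prob_space.indep_vars_compose2[OF measure_pmf.prob_space_axioms
          indep_vars_Pi_pmf[OF assms(1)]]) simp
  then have "measure_pmf.expectation (Pi_pmf J d q) (\<lambda>x. \<Prod>j\<in>J. f j (x j)) =
    (\<Prod>j\<in>J. measure_pmf.expectation (Pi_pmf J d q) (\<lambda>x. f j (x j)))"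
    using fin by (intro prob_space.indep_vars_lebesgue_integral[OF measure_pmf.prob_space_axioms assms(1)])
  also have "\<dots> = (\<Prod>j\<in>J. measure_pmf.expectation (map_pmf (\<lambda>x. x j) (Pi_pmf J d q)) (f j))"
    by simp
  also have "\<dots> = (\<Prod>j\<in>J. measure_pmf.expectation (q j) (f j))"
    using comp by (intro prod.cong) simp_all
  finally show ?thesis .
qed

text \<open>The default value 0 of \<open>Pi_pmf\<close> makes the coordinates outside
  \<open>J\<close> integral as well, so \<open>z\<close> can be chosen on the whole index
  type.\<close>

lemma set_Pi_pmf_mu_integral:
  assumes "0 \<le> p" "p \<le> 1/2" "finite J" "x \<in> set_pmf (Pi_pmf J 0 (\<lambda>_. mu p))"
  obtains z :: "'j \<Rightarrow> int" where "\<And>j. \<bar>z j\<bar> \<le> 1" "x = (\<lambda>j. of_int (z j))"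
proof -
  have "\<exists>z::int. \<bar>z\<bar> \<le> 1 \<and> x j = of_int z" for j
  proof -
    have "x j \<in> {1, -1, 0}"
      using assms(4) set_pmf_mu_subset[OF assms(1,2)]
      unfolding set_Pi_pmf[OF assms(3)] PiE_dflt_def by (cases "j \<in> J") auto
    then show ?thesis
      by (elim insertE emptyE) (auto intro: exI[of _ 1] exI[of _ "-1"] exI[of _ 0])
  qed
  then obtain z :: "'j \<Rightarrow> int" where "\<And>j. \<bar>z j\<bar> \<le> 1" "\<And>j. x j = of_int (z j)"
    by metis
  then show ?thesis
    using that[of z] by auto
qed

lemma integrable_Pi_pmf_mu:
  fixes f :: "('j \<Rightarrow> rat) \<Rightarrow> complex"
  assumes "0 \<le> p" "p \<le> 1/2" "finite J"
  shows "integrable (measure_pmf (Pi_pmf J 0 (\<lambda>_. mu p))) f"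
proof (rule integrable_measure_pmf_finite)
  have "finite (set_pmf (mu p))"
    using set_pmf_mu_subset[OF assms(1,2)] by (rule finite_subset) simp
  then show "finite (set_pmf (Pi_pmf J 0 (\<lambda>_. mu p)))"
    unfolding set_Pi_pmf[OF assms(3)] using assms(3) by (intro finite_PiE_dflt) auto
qed

text \<open>By orthogonality, \<open>real M ^ card S\<close> times the indicator of the congruences
  is a sum of characters over all frequency vectors \<theta>. By independence, the expectation of
  each character is a product over the coordinates.\<close>

lemma prob_linear_congruences:
  fixes c :: "'i \<Rightarrow> 'j \<Rightarrow> int" and v :: "'i \<Rightarrow> int" and M :: nat
  assumes p: "0 \<le> p" "p \<le> 1/2" and fin: "finite S" "finite J" and M: "M > 0"
  shows "complex_of_real (real M ^ card S * measure_pmf.prob (Pi_pmf J 0 (\<lambda>_. mu p))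
      {x. \<forall>i\<in>S. \<exists>m. (\<Sum>j\<in>J. of_int (c i j) * x j) = of_int (v i + int M * m)}) =
    (\<Sum>\<theta>\<in>PiE S (\<lambda>_. {..<M}). cis (- (2 * pi / M * (\<Sum>i\<in>S. real (\<theta> i) * of_int (v i)))) *
       of_real (\<Prod>j\<in>J. lazy_char p (2 * pi / M * (\<Sum>i\<in>S. real (\<theta> i) * of_int (c i j)))))"
    (is "_ = (\<Sum>\<theta>\<in>?T. ?e \<theta> * of_real (\<Prod>j\<in>J. lazy_char p (?\<alpha> \<theta> j)))")
proof -
  let ?P = "Pi_pmf J 0 (\<lambda>_. mu p)"
  let ?E = "{x. \<forall>i\<in>S. \<exists>m. (\<Sum>j\<in>J. of_int (c i j) * x j) = of_int (v i + int M * m)} :: ('j \<Rightarrow> rat) set"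
  have finT: "finite ?T" using fin by (intro finite_PiE) auto
  have "complex_of_real (real M ^ card S * measure_pmf.prob ?P ?E) =
      measure_pmf.expectation ?P (\<lambda>x. of_real (real M ^ card S * indicator ?E x))"
    by simp
  also have "\<dots> = measure_pmf.expectation ?P
      (\<lambda>x. \<Sum>\<theta>\<in>?T. ?e \<theta> * (\<Prod>j\<in>J. cis (?\<alpha> \<theta> j * real_of_rat (x j))))"
  proof (intro integral_cong_AE AE_pmfI)
    fix x assume "x \<in> set_pmf ?P"
    then obtain z :: "'j \<Rightarrow> int" where z: "x = (\<lambda>j. of_int (z j))"
      using set_Pi_pmf_mu_integral[OF p fin(2)] by blast
    \<comment> \<open>The defect of congruence \<open>i\<close>: all congruences hold exactly when
      \<open>M\<close> divides every \<open>w i\<close>.\<close>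
    define w where "w i = (\<Sum>j\<in>J. c i j * z j) - v i" for i
    have "?e \<theta> * (\<Prod>j\<in>J. cis (?\<alpha> \<theta> j * real_of_rat (x j))) =
        (\<Prod>i\<in>S. cis (2 * pi / M * (real (\<theta> i) * of_int (w i))))" for \<theta> :: "'i \<Rightarrow> nat"
    proof -
      have "(\<Sum>j\<in>J. ?\<alpha> \<theta> j * real_of_rat (x j)) =
          2 * pi / M * (\<Sum>i\<in>S. real (\<theta> i) * (\<Sum>j\<in>J. of_int (c i j) * of_int (z j)))"
        unfolding z sum_distrib_left sum_distrib_right
        by (subst sum.swap) (simp add: mult_ac)
      moreover have "(\<Sum>i\<in>S. real (\<theta> i) * of_int (w i)) =
          (\<Sum>i\<in>S. real (\<theta> i) * (\<Sum>j\<in>J. of_int (c i j) * of_int (z j))) -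
          (\<Sum>i\<in>S. real (\<theta> i) * of_int (v i))"
        by (simp add: w_def right_diff_distrib sum_subtractf)
      ultimately have "(\<Sum>i\<in>S. 2 * pi / M * (real (\<theta> i) * of_int (w i))) =
          - (2 * pi / M * (\<Sum>i\<in>S. real (\<theta> i) * of_int (v i))) +
          (\<Sum>j\<in>J. ?\<alpha> \<theta> j * real_of_rat (x j))"
        unfolding sum_distrib_left[symmetric] by (simp only: right_diff_distrib)
      then show ?thesis
        by (simp only: cis_sum[symmetric] cis_mult)
    qed
    \<comment> \<open>The sum over all \<theta> factors into one character sum per equation.\<close>
    then have "(\<Sum>\<theta>\<in>?T. ?e \<theta> * (\<Prod>j\<in>J. cis (?\<alpha> \<theta> j * real_of_rat (x j)))) =
        (\<Prod>i\<in>S. \<Sum>a<M. cis (2 * pi / M * (real a * of_int (w i))))"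
      using fin by (simp add: prod_sum_PiE)
    also have "\<dots> = (\<Prod>i\<in>S. if int M dvd w i then of_nat M else 0)"
      unfolding sum_cis_multiples[OF M] ..
    also have "\<dots> = (if \<forall>i\<in>S. int M dvd w i then of_nat M ^ card S else 0)"
      using fin(1) by (auto simp: prod_zero_iff)
    also have "(\<forall>i\<in>S. int M dvd w i) \<longleftrightarrow> x \<in> ?E"
    proof -
      have "int M dvd w i \<longleftrightarrow> (\<exists>m. (\<Sum>j\<in>J. c i j * z j) = v i + int M * m)" for i
        unfolding w_def dvd_def by (simp add: algebra_simps)
      also have "\<dots> i \<longleftrightarrow> (\<exists>m. (\<Sum>j\<in>J. of_int (c i j) * x j) = of_int (v i + int M * m))" for i
        unfolding z of_int_mult[symmetric] of_int_sum[symmetric] of_int_eq_iff ..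
      finally show ?thesis by simp
    qed
    finally show "complex_of_real (real M ^ card S * indicator ?E x) =
        (\<Sum>\<theta>\<in>?T. ?e \<theta> * (\<Prod>j\<in>J. cis (?\<alpha> \<theta> j * real_of_rat (x j))))"
      by (simp split: split_indicator)
  qed simp_all
  also have "\<dots> = (\<Sum>\<theta>\<in>?T. ?e \<theta> * measure_pmf.expectation ?P (\<lambda>x. \<Prod>j\<in>J. cis (?\<alpha> \<theta> j * real_of_rat (x j))))"
    using integrable_Pi_pmf_mu[OF p fin(2)] by (subst Bochner_Integration.integral_sum) auto
  also have "\<dots> = (\<Sum>\<theta>\<in>?T. ?e \<theta> * of_real (\<Prod>j\<in>J. lazy_char p (?\<alpha> \<theta> j)))"
  proof (intro sum.cong refl arg_cong2[where f = "(*)"])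
    fix \<theta> :: "'i \<Rightarrow> nat"
    have "finite (set_pmf (mu p))"
      using set_pmf_mu_subset[OF p] by (rule finite_subset) simp
    then show "measure_pmf.expectation ?P (\<lambda>x. \<Prod>j\<in>J. cis (?\<alpha> \<theta> j * real_of_rat (x j))) =
        of_real (\<Prod>j\<in>J. lazy_char p (?\<alpha> \<theta> j))"
      using expectation_prod_Pi_pmf_complex[OF fin(2), of "\<lambda>_. mu p" 0 "\<lambda>j y. cis (?\<alpha> \<theta> j * real_of_rat y)"]
      unfolding expectation_mu_cis[OF p] of_real_prod by blast
  qed
  finally show ?thesis .
qed

subsection \<open>Comparison of the characteristic functions\<close>

lemma lazy_char_ge:
  assumes "0 \<le> p"
  shows "1 - 4 * p \<le> lazy_char p y"
  using mult_left_mono[OF cos_ge_minus_one[of y], of "2 * p"] assms unfolding lazy_char_def by simp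

text \<open>With s = |cos z|, cos (4 z) is a polynomial in s, and 1 - (1 - cos (4 z)) / 16 - s
  equals (1 - s) (1 - s^2 (1 + s) / 2), whose factors are nonnegative on [0, 1]. The 1/16 is twice
  the bound 1/32 on \<open>p\<close>.\<close>

lemma abs_cos_le_lazy_char:
  assumes "p \<le> 1/32"
  shows "\<bar>cos z\<bar> \<le> lazy_char p (4 * z)"
proof -
  define s where "s = \<bar>cos z\<bar>"
  have s: "0 \<le> s" "s \<le> 1" "s\<^sup>2 = (cos z)\<^sup>2"
    unfolding s_def by (simp_all add: abs_le_iff cos_ge_minus_one minus_le_iff)
  have "cos (2 * z) = 2 * s\<^sup>2 - 1"
    unfolding s(3) by (rule cos_double_cos)
  then have cos4: "cos (4 * z) = 2 * (2 * s\<^sup>2 - 1)\<^sup>2 - 1"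
    using cos_double_cos[of "2 * z"] by simp
  have "s\<^sup>2 * (1 + s) \<le> 1 * 2"
    using s by (intro mult_mono power_le_one) auto
  then have "0 \<le> (1 - s) * (1 - s\<^sup>2 * (1 + s) / 2)"
    using s by simp
  also have "\<dots> = 1 - (1 - cos (4 * z)) / 16 - s"
    unfolding cos4 by (simp add: field_simps power2_eq_square)
  also have "\<dots> \<le> lazy_char p (4 * z) - s"
  proof -
    have "p * (1 - cos (4 * z)) \<le> 1/32 * (1 - cos (4 * z))"
      using assms by (intro mult_right_mono) simp_all
    moreover have "lazy_char p (4 * z) = 1 - 2 * (p * (1 - cos (4 * z)))"
      unfolding lazy_char_def by (simp add: algebra_simps)
    ultimately show ?thesis by linarith
  qed
  finally show ?thesis unfolding s_def by simp
qed

lemma abs_cos_add_pi_multiple: "\<bar>cos (y + pi * of_int m)\<bar> = \<bar>cos y\<bar>"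
proof -
  have "sin (pi * of_int m) = 0" by (simp add: sin_integer_2pi sin_zero_iff_int2 mult.commute)
  moreover from this have "\<bar>cos (pi * of_int m)\<bar> = 1"
    using sin_cos_squared_add[of "pi * of_int m"] by (simp add: power2_eq_1_iff abs_if split: if_splits)
  ultimately show ?thesis by (simp add: cos_add abs_mult)
qed

text \<open>As \<open>c\<close> is odd, odd \<open>b\<close> give odd multiples of pi/2 and even
  \<open>b\<close> give multiples of pi. The absolute cosine has period pi, so the four terms are
  |cos y| and |sin y|, twice each.\<close>

lemma sum_abs_cos_quarter_shifts:
  fixes c :: int
  assumes "odd c"
  shows "(\<Sum>b<4. \<bar>cos (y + pi / 2 * (real b * of_int c))\<bar>) \<le> 49 / 16"
proof -
  obtain m where c: "c = 2 * m + 1" using assms oddE by blast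
  have odd: "\<bar>cos (y + pi / 2 * of_int (2 * l + 1))\<bar> = \<bar>sin y\<bar>" for l
  proof -
    have "y + pi / 2 * of_int (2 * l + 1) = (y + pi / 2) + pi * of_int l"
      by (simp add: field_simps)
    then have "\<bar>cos (y + pi / 2 * of_int (2 * l + 1))\<bar> = \<bar>cos (y + pi / 2)\<bar>"
      by (simp only: abs_cos_add_pi_multiple)
    then show ?thesis by (simp add: cos_add)
  qed
  have even: "\<bar>cos (y + pi / 2 * of_int (2 * l))\<bar> = \<bar>cos y\<bar>" for l
    using abs_cos_add_pi_multiple[of y l] by (simp add: field_simps)
  have four: "(\<Sum>b<4. f b) = f 0 + f 1 + f 2 + f 3" for f :: "nat \<Rightarrow> real"
    by (simp add: eval_nat_numeral)
  have "\<bar>cos (y + pi / 2 * (real 1 * of_int c))\<bar> = \<bar>sin y\<bar>"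
    using odd[of m] unfolding c by simp
  moreover have "\<bar>cos (y + pi / 2 * (real 2 * of_int c))\<bar> = \<bar>cos y\<bar>"
    using even[of c] by simp
  moreover have "\<bar>cos (y + pi / 2 * (real 3 * of_int c))\<bar> = \<bar>sin y\<bar>"
    using odd[of "3 * m + 1"] unfolding c by (simp add: algebra_simps)
  ultimately have "(\<Sum>b<4. \<bar>cos (y + pi / 2 * (real b * of_int c))\<bar>) = 2 * (\<bar>cos y\<bar> + \<bar>sin y\<bar>)"
    unfolding four by simp
  \<comment> \<open>The true maximum is the square root of 2; 49/32 is a rational upper bound whose
    double, 49/16, equals 7/2 * 7/8.\<close>
  also have "\<bar>cos y\<bar> + \<bar>sin y\<bar> \<le> 49 / 32"
  proof (rule power2_le_imp_le)
    have "(\<bar>cos y\<bar> + \<bar>sin y\<bar>)\<^sup>2 \<le> 2"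
      using sum_squares_bound[of "\<bar>cos y\<bar>" "\<bar>sin y\<bar>"] by (simp add: power2_sum)
    also have "(2::real) \<le> (49 / 32)\<^sup>2" by (simp add: power2_eq_square)
    finally show "(\<bar>cos y\<bar> + \<bar>sin y\<bar>)\<^sup>2 \<le> (49 / 32)\<^sup>2" .
  qed simp
  finally show ?thesis by simp
qed

section \<open>Averaging over quarter-period shifts\<close>

lemma sum_PiE_base_expansion:
  fixes f :: "('i \<Rightarrow> nat) \<Rightarrow> 'a::comm_monoid_add"
  assumes "N > 0"
  shows "(\<Sum>\<theta>\<in>PiE S (\<lambda>_. {..<q * N}). f \<theta>) =
    (\<Sum>a\<in>PiE S (\<lambda>_. {..<N}). \<Sum>b\<in>PiE S (\<lambda>_. {..<q}). f (\<lambda>i\<in>S. a i + N * b i))"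
proof -
  have "(\<Sum>\<theta>\<in>PiE S (\<lambda>_. {..<q * N}). f \<theta>) =
    (\<Sum>(a, b)\<in>PiE S (\<lambda>_. {..<N}) \<times> PiE S (\<lambda>_. {..<q}). f (\<lambda>i\<in>S. a i + N * b i))"
  \<comment> \<open>The bijection is coordinatewise division with remainder by \<open>N\<close>.
    Restriction to \<open>S\<close> supplies the value \<open>undefined\<close> off \<open>S\<close>
    that extensionality in \<open>PiE\<close> demands.\<close>
  proof (rule sum.reindex_bij_witness)
    fix \<theta> assume \<theta>: "\<theta> \<in> PiE S (\<lambda>_. {..<q * N})"
    have "(\<lambda>i\<in>S. (\<lambda>i\<in>S. \<theta> i mod N) i + N * (\<lambda>i\<in>S. \<theta> i div N) i) i = \<theta> i" for i
      using PiE_arb[OF \<theta>, of i] by (cases "i \<in> S") simp_all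
    then have inv: "(\<lambda>i\<in>S. (\<lambda>i\<in>S. \<theta> i mod N) i + N * (\<lambda>i\<in>S. \<theta> i div N) i) = \<theta>"
      by blast
    show "(\<lambda>(a, b). \<lambda>i\<in>S. a i + N * b i) (\<lambda>i\<in>S. \<theta> i mod N, \<lambda>i\<in>S. \<theta> i div N) = \<theta>"
      unfolding prod.case by (rule inv)
    show "(case (\<lambda>i\<in>S. \<theta> i mod N, \<lambda>i\<in>S. \<theta> i div N) of (a, b) \<Rightarrow> f (\<lambda>i\<in>S. a i + N * b i)) = f \<theta>"
      unfolding prod.case inv ..
    have "\<theta> i < q * N" if "i \<in> S" for i
      using PiE_mem[OF \<theta> that] by simp
    then show "(\<lambda>i\<in>S. \<theta> i mod N, \<lambda>i\<in>S. \<theta> i div N) \<in> PiE S (\<lambda>_. {..<N}) \<times> PiE S (\<lambda>_. {..<q})"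
      using assms by (simp add: less_mult_imp_div_less)
  next
    fix ab assume "ab \<in> PiE S (\<lambda>_. {..<N}) \<times> PiE S (\<lambda>_. {..<q})"
    then obtain a b where ab: "ab = (a, b)" and a: "a \<in> PiE S (\<lambda>_. {..<N})" and b: "b \<in> PiE S (\<lambda>_. {..<q})"
      by blast
    let ?\<theta> = "\<lambda>i\<in>S. a i + N * b i"
    have less: "a i < N" "b i < q" if "i \<in> S" for i
      using PiE_mem[OF a that] PiE_mem[OF b that] by simp_all
    have "(\<lambda>i\<in>S. ?\<theta> i mod N) i = a i" "(\<lambda>i\<in>S. ?\<theta> i div N) i = b i" for i
      using PiE_arb[OF a, of i] PiE_arb[OF b, of i] less[of i] by (cases "i \<in> S"; simp)+
    then have "(\<lambda>i\<in>S. ?\<theta> i mod N) = a" "(\<lambda>i\<in>S. ?\<theta> i div N) = b"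
      by blast+
    then show "(\<lambda>i\<in>S. (\<lambda>(a, b). \<lambda>i\<in>S. a i + N * b i) ab i mod N,
        \<lambda>i\<in>S. (\<lambda>(a, b). \<lambda>i\<in>S. a i + N * b i) ab i div N) = ab"
      unfolding ab prod.case by (simp only:)
    have "a i + N * b i < q * N" if "i \<in> S" for i
    proof -
      have "a i + N * b i < N * Suc (b i)" using less(1)[OF that] by simp
      also have "\<dots> \<le> N * q" using less(2)[OF that] by (intro mult_le_mono2) simp
      finally show ?thesis by (simp add: mult.commute)
    qed
    then show "(\<lambda>(a, b). \<lambda>i\<in>S. a i + N * b i) ab \<in> PiE S (\<lambda>_. {..<q * N})"
      unfolding ab prod.case by simp
  qed
  then show ?thesis unfolding sum.cartesian_product .
qed

text \<open>Shifting \<open>\<theta> i\<close> by multiples of \<open>N\<close>, a quarter period, leaves every factor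
  \<^term>\<open>lazy_char p (4 * y)\<close> unchanged, while the average of each pivot factor over the four shifts
  drops below \<^term>\<open>49/64 :: real\<close>.\<close>

lemma average_prod_abs_cos_le:
  fixes c :: "'i \<Rightarrow> 'i \<Rightarrow> int"
  assumes "finite J" "S \<subseteq> J" and odd: "\<And>i. i \<in> S \<Longrightarrow> odd (c i i)"
    and zero: "\<And>i j. i \<in> S \<Longrightarrow> j \<in> S \<Longrightarrow> i \<noteq> j \<Longrightarrow> c i j = 0"
    and p: "0 \<le> p" "p \<le> 1/32" and N: "N > 0"
  shows "(\<Sum>\<theta>\<in>PiE S (\<lambda>_. {..<4 * N}). \<Prod>j\<in>J.
      \<bar>cos (2 * pi / real (4 * N) * (\<Sum>i\<in>S. real (\<theta> i) * of_int (c i j)))\<bar>) \<le>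
    (7/2) ^ card S * (\<Sum>a\<in>PiE S (\<lambda>_. {..<N}). \<Prod>j\<in>J.
      lazy_char p (2 * pi / real N * (\<Sum>i\<in>S. real (a i) * of_int (c i j))))"
proof -
  have finS: "finite S" using assms(1,2) finite_subset by blast
  have pos: "7/8 \<le> lazy_char p y" for y
    using lazy_char_ge[OF p(1), of y] p by simp
  \<comment> \<open>Modulo \<open>4 * N\<close> the frequency \<open>a i + N * b i\<close> yields
    the angle \<open>Y a j\<close> plus a multiple of pi/2 recorded by \<open>C b j\<close>, whereas
    \<open>a\<close> modulo \<open>N\<close> yields the angle \<open>4 * Y a j\<close>.\<close>
  define Y where "Y a j = pi / real (2 * N) * (\<Sum>i\<in>S. real (a i) * of_int (c i j))" for a :: "'i \<Rightarrow> nat" and j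
  define C where "C b j = (\<Sum>i\<in>S. int (b i) * c i j)" for b :: "'i \<Rightarrow> nat" and j
  have angle: "2 * pi / real (4 * N) * (\<Sum>i\<in>S. real ((\<lambda>i\<in>S. a i + N * b i) i) * of_int (c i j)) =
      Y a j + pi / 2 * of_int (C b j)" for a b j
  proof -
    have "(\<Sum>i\<in>S. real ((\<lambda>i\<in>S. a i + N * b i) i) * of_int (c i j)) =
      (\<Sum>i\<in>S. real (a i) * of_int (c i j)) + real N * of_int (C b j)"
      unfolding C_def by (simp add: sum_distrib_left distrib_right sum.distrib mult.assoc)
    then show ?thesis
      unfolding Y_def using N by (simp add: field_simps)
  qed
  have Y4: "2 * pi / real N * (\<Sum>i\<in>S. real (a i) * of_int (c i j)) = 4 * Y a j" for a j
    unfolding Y_def by simp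
  have off_pivot: "\<bar>cos (Y a j + pi / 2 * of_int (C b j))\<bar> \<le> lazy_char p (4 * Y a j)" for a b j
  proof -
    have "4 * (Y a j + pi / 2 * of_int (C b j)) = 4 * Y a j + 2 * pi * of_int (C b j)"
      by (simp add: algebra_simps)
    then have "cos (4 * (Y a j + pi / 2 * of_int (C b j))) = cos (4 * Y a j)"
      by (simp only: cos_add cos_int_2pin sin_int_2pin mult_1_right mult_zero_right diff_zero)
    then show ?thesis
      using abs_cos_le_lazy_char[OF p(2), of "Y a j + pi / 2 * of_int (C b j)"]
      unfolding lazy_char_def by simp
  qed
  \<comment> \<open>Within the pivot block, column \<open>i\<close> is nonzero only on the diagonal.
    The shift at pivot \<open>i\<close> thus depends on \<open>b i\<close> alone, and the sum over
    \<open>b\<close> will factor over the pivots.\<close>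
  have pivot: "C b i = int (b i) * c i i" if "i \<in> S" for b i
  proof -
    have "(\<Sum>l\<in>S - {i}. int (b l) * c l i) = 0"
      using zero that by (intro sum.neutral) auto
    then show ?thesis
      unfolding C_def sum.remove[OF finS that] by (simp only: add_0_right)
  qed
  have "(\<Sum>b\<in>PiE S (\<lambda>_. {..<4::nat}). \<Prod>j\<in>J. \<bar>cos (Y a j + pi / 2 * of_int (C b j))\<bar>)
      \<le> (7/2) ^ card S * (\<Prod>j\<in>J. lazy_char p (4 * Y a j))" for a
  proof -
    let ?L = "\<lambda>A. \<Prod>j\<in>A. lazy_char p (4 * Y a j)"
    have pos': "0 \<le> ?L A" for A
      by (intro prod_nonneg) (rule order_trans[OF _ pos], simp)
    have split: "prod f J = prod f (J - S) * prod f S" for f :: "'i \<Rightarrow> real"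
      using assms(1,2) by (rule prod.subset_diff[rotated])
    have "(\<Sum>b\<in>PiE S (\<lambda>_. {..<4::nat}). \<Prod>j\<in>J. \<bar>cos (Y a j + pi / 2 * of_int (C b j))\<bar>) \<le>
        (\<Sum>b\<in>PiE S (\<lambda>_. {..<4::nat}). ?L (J - S) *
          (\<Prod>i\<in>S. \<bar>cos (Y a i + pi / 2 * (real (b i) * of_int (c i i)))\<bar>))"
    proof (rule sum_mono)
      fix b :: "'i \<Rightarrow> nat"
      have "(\<Prod>j\<in>J - S. \<bar>cos (Y a j + pi / 2 * of_int (C b j))\<bar>) \<le> ?L (J - S)"
        using off_pivot by (intro prod_mono) simp
      moreover have "(\<Prod>i\<in>S. \<bar>cos (Y a i + pi / 2 * of_int (C b i))\<bar>) =
          (\<Prod>i\<in>S. \<bar>cos (Y a i + pi / 2 * (real (b i) * of_int (c i i)))\<bar>)"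
        using pivot by (intro prod.cong) simp_all
      ultimately show "(\<Prod>j\<in>J. \<bar>cos (Y a j + pi / 2 * of_int (C b j))\<bar>) \<le>
          ?L (J - S) * (\<Prod>i\<in>S. \<bar>cos (Y a i + pi / 2 * (real (b i) * of_int (c i i)))\<bar>)"
        unfolding split by (simp add: mult_right_mono prod_nonneg)
    qed
    also have "\<dots> = ?L (J - S) * (\<Prod>i\<in>S. \<Sum>b<4. \<bar>cos (Y a i + pi / 2 * (real b * of_int (c i i)))\<bar>)"
      by (simp add: sum_distrib_left[symmetric] prod_sum_PiE finS)
    also have "\<dots> \<le> ?L (J - S) * (\<Prod>i\<in>S. 7/2 * lazy_char p (4 * Y a i))"
    proof (intro mult_left_mono pos' prod_mono conjI sum_nonneg)
      fix i assume "i \<in> S"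
      then have "(\<Sum>b<4. \<bar>cos (Y a i + pi / 2 * (real b * of_int (c i i)))\<bar>) \<le> 49 / 16"
        using odd sum_abs_cos_quarter_shifts by blast
      \<comment> \<open>49/16 = 7/2 * 7/8, and 7/8 is at most the factor by \<open>pos\<close>. The
        cost 7/2 per pivot is four shifts times 7/8.\<close>
      also have "\<dots> \<le> 7/2 * lazy_char p (4 * Y a i)"
        using pos[of "4 * Y a i"] by simp
      finally show "(\<Sum>b<4. \<bar>cos (Y a i + pi / 2 * (real b * of_int (c i i)))\<bar>) \<le> 7/2 * lazy_char p (4 * Y a i)" .
    qed simp
    also have "\<dots> = (7/2) ^ card S * ?L J"
      unfolding split prod.distrib by simp
    finally show ?thesis .
  qed
  then show ?thesis
    unfolding sum_PiE_base_expansion[OF N] angle Y4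
    by (subst sum_distrib_left) (intro sum_mono)
qed

text \<open>For the sign vector, weakening the equations to congruences modulo \<open>4 * N\<close>
  gives an upper bound. For the lazy vector, \<open>N\<close> is so large that congruences modulo
  \<open>N\<close> are equivalent to the equations on the support, so its Fourier sum is exact. The
  normalisations differ by \<open>4 ^ card S\<close>, which turns 7/2 per pivot into 7/8.\<close>

lemma prob_linear_system_le:
  fixes c :: "'i \<Rightarrow> 'i \<Rightarrow> int" and v :: "'i \<Rightarrow> int"
  assumes "finite J" "S \<subseteq> J" and odd: "\<And>i. i \<in> S \<Longrightarrow> odd (c i i)"
    and zero: "\<And>i j. i \<in> S \<Longrightarrow> j \<in> S \<Longrightarrow> i \<noteq> j \<Longrightarrow> c i j = 0"
    and p: "0 \<le> p" "p \<le> 1/32"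
  shows "measure_pmf.prob (Pi_pmf J 0 (\<lambda>_. mu (1/2)))
      {x. \<forall>i\<in>S. (\<Sum>j\<in>J. of_int (c i j) * x j) = of_int (v i)} \<le>
    (7/8) ^ card S * measure_pmf.prob (Pi_pmf J 0 (\<lambda>_. mu p))
      {x. \<forall>i\<in>S. (\<Sum>j\<in>J. of_int (c i j) * x j) = 0}"
proof -
  let ?PX = "measure_pmf.prob (Pi_pmf J 0 (\<lambda>_. mu (1/2)))"
  let ?PY = "measure_pmf.prob (Pi_pmf J 0 (\<lambda>_. mu p))"
  let ?A = "{x. \<forall>i\<in>S. (\<Sum>j\<in>J. of_int (c i j) * x j) = of_int (v i)} :: ('i \<Rightarrow> rat) set"
  let ?B = "{x. \<forall>i\<in>S. (\<Sum>j\<in>J. of_int (c i j) * x j) = 0} :: ('i \<Rightarrow> rat) set"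
  have finS: "finite S" using assms(1,2) finite_subset by blast
  \<comment> \<open>For entries bounded by 1 every left-hand side is at most this double sum in
    absolute value, hence strictly below \<open>N\<close>, so it is a multiple of \<open>N\<close>
    only if it is 0.\<close>
  define N where "N = Suc (nat (\<Sum>i\<in>S. \<Sum>j\<in>J. \<bar>c i j\<bar>))"
  have N: "N > 0" "(\<Sum>i\<in>S. \<Sum>j\<in>J. \<bar>c i j\<bar>) < int N"
    unfolding N_def by (simp_all add: sum_nonneg)
  let ?X = "\<lambda>\<theta> j. 2 * pi / real (4 * N) * (\<Sum>i\<in>S. real (\<theta> i) * of_int (c i j))"
  let ?Y = "\<lambda>a j. 2 * pi / real N * (\<Sum>i\<in>S. real (a i) * of_int (c i j))"
  have X: "real (4 * N) ^ card S * ?PX ?A \<le>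
      (\<Sum>\<theta>\<in>PiE S (\<lambda>_. {..<4 * N}). \<Prod>j\<in>J. \<bar>cos (?X \<theta> j)\<bar>)"
  proof -
    let ?A' = "{x. \<forall>i\<in>S. \<exists>m. (\<Sum>j\<in>J. of_int (c i j) * x j) = of_int (v i + int (4 * N) * m)}"
    have "?A \<subseteq> ?A'"
      by (auto intro!: exI[of _ 0])
    then have "?PX ?A \<le> ?PX ?A'"
      by (intro measure_pmf.finite_measure_mono) simp_all
    then have "real (4 * N) ^ card S * ?PX ?A \<le> norm (complex_of_real (real (4 * N) ^ card S * ?PX ?A'))"
      unfolding norm_of_real by (simp add: mult_left_mono)
    also have "\<dots> \<le> (\<Sum>\<theta>\<in>PiE S (\<lambda>_. {..<4 * N}).
        norm (cis (- (2 * pi / real (4 * N) * (\<Sum>i\<in>S. real (\<theta> i) * of_int (v i)))) *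
        complex_of_real (\<Prod>j\<in>J. lazy_char (1/2) (?X \<theta> j))))"
    proof -
      have half: "0 \<le> (1/2 :: real)" "(1/2 :: real) \<le> 1/2" and "4 * N > 0"
        using N(1) by simp_all
      then show ?thesis
        unfolding prob_linear_congruences[OF half finS assms(1) \<open>4 * N > 0\<close>] by (intro norm_sum)
    qed
    also have "\<dots> = (\<Sum>\<theta>\<in>PiE S (\<lambda>_. {..<4 * N}). \<Prod>j\<in>J. \<bar>cos (?X \<theta> j)\<bar>)"
    proof -
      have "lazy_char (1/2) y = cos y" for y
        by (simp add: lazy_char_def)
      then show ?thesis
        by (simp only: norm_mult norm_cis norm_of_real abs_prod mult_1_left)
    qed
    finally show ?thesis .
  qed
  have Y: "real N ^ card S * ?PY ?B = (\<Sum>a\<in>PiE S (\<lambda>_. {..<N}). \<Prod>j\<in>J. lazy_char p (?Y a j))"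
  proof -
    \<comment> \<open>The \<open>0 +\<close> keeps the shape of
      \<open>prob_linear_congruences\<close> with \<open>v\<close> identically 0.\<close>
    let ?B' = "{x. \<forall>i\<in>S. \<exists>m. (\<Sum>j\<in>J. of_int (c i j) * x j) = of_int (0 + int N * m)}"
    have "?PY ?B = ?PY ?B'"
    proof (intro measure_pmf.finite_measure_eq_AE AE_pmfI)
      fix x assume "x \<in> set_pmf (Pi_pmf J 0 (\<lambda>_. mu p))"
      then obtain z :: "'i \<Rightarrow> int" where z: "\<And>j. \<bar>z j\<bar> \<le> 1" "x = (\<lambda>j. of_int (z j))"
        using set_Pi_pmf_mu_integral[of p J x] p assms(1) by auto
      have "m = 0" if i: "i \<in> S" and "(\<Sum>j\<in>J. of_int (c i j) * x j) = of_int (0 + int N * m)" for i m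
      proof -
        have eq: "(\<Sum>j\<in>J. c i j * z j) = int N * m"
          using that(2) unfolding z(2) add_0 of_int_mult[symmetric] of_int_sum[symmetric] of_int_eq_iff .
        have "\<bar>\<Sum>j\<in>J. c i j * z j\<bar> \<le> (\<Sum>j\<in>J. \<bar>c i j\<bar>)"
          using z(1) by (intro sum_abs[THEN order_trans] sum_mono)
            (simp add: abs_mult mult_left_le)
        also have "\<dots> \<le> (\<Sum>i\<in>S. \<Sum>j\<in>J. \<bar>c i j\<bar>)"
          using i finS by (intro member_le_sum) (auto simp: sum_nonneg)
        also have "\<dots> < int N" by (rule N)
        finally have "int N * \<bar>m\<bar> < int N * 1"
          unfolding eq by (simp add: abs_mult)
        then show "m = 0"
          by (simp only: mult_less_cancel_left) auto
      qed
      then have "(\<Sum>j\<in>J. of_int (c i j) * x j) = 0 \<longleftrightarrow>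
          (\<exists>m. (\<Sum>j\<in>J. of_int (c i j) * x j) = of_int (0 + int N * m))" if "i \<in> S" for i
        using that by (metis add_0 mult_zero_right of_int_0)
      then show "x \<in> ?B \<longleftrightarrow> x \<in> ?B'"
        by (simp only: mem_Collect_eq cong: ball_cong)
    qed simp_all
    moreover have "complex_of_real (real N ^ card S * ?PY ?B') =
        complex_of_real (\<Sum>a\<in>PiE S (\<lambda>_. {..<N}). \<Prod>j\<in>J. lazy_char p (?Y a j))"
    proof -
      have trivial: "cis (- (2 * pi / real N * (\<Sum>i\<in>S. real (a i) * of_int 0))) = 1" for a :: "'i \<Rightarrow> nat"
        by simp
      have "p \<le> 1/2" using p(2) by simp
      note prob_linear_congruences[OF p(1) this finS assms(1) N(1), of c "\<lambda>_. 0"]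
      then show ?thesis
        unfolding trivial mult_1_left of_real_sum .
    qed
    ultimately show ?thesis by (simp only: of_real_eq_iff)
  qed
  have "real (4 * N) ^ card S * ?PX ?A \<le> (7/2) ^ card S * (real N ^ card S * ?PY ?B)"
    using X average_prod_abs_cos_le[OF assms N(1)] unfolding Y by (rule order_trans)
  also have "\<dots> = real (4 * N) ^ card S * ((7/8) ^ card S * ?PY ?B)"
  proof -
    have "real (4 * N) ^ card S * (7/8) ^ card S = (7/2) ^ card S * real N ^ card S"
      unfolding power_mult_distrib[symmetric] by simp
    then show ?thesis
      unfolding mult.assoc[symmetric] by (simp only:)
  qed
  finally show ?thesis
    by (rule mult_left_le_imp_le) (use N(1) in simp)
qed

section \<open>Transfer to subspaces and arbitrary translates\<close>

theorem proposition2p1: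
  shows "\<exists>(\<gamma>::real) (k0::nat). \<gamma> < 1 \<and> k0 \<ge> 1 \<and>
    (\<forall>(p::real) (k::nat) (n::nat) (V :: rat Matrix.vec set).
      0 < p \<and> p \<le> 1/32 \<and> k0 \<le> k \<and> k \<le> n \<and>
      lin_subspace n V \<and> subspace_dim n V = n - k \<longrightarrow>
      (SUP t\<in>carrier_vec n. measure_pmf.prob (mu_vec (1/2) n) {x. x + t \<in> V})
        \<le> \<gamma> ^ k * measure_pmf.prob (mu_vec p n) V)"
proof (intro exI[of _ "7/8"] exI[of _ 1] conjI allI impI)
  fix p :: real and k n :: nat and V :: "rat Matrix.vec set"
  assume "0 < p \<and> p \<le> 1/32 \<and> 1 \<le> k \<and> k \<le> n \<and> lin_subspace n V \<and> subspace_dim n V = n - k"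
  then have p: "0 \<le> p" "p \<le> 1/32" and V: "lin_subspace n V" "subspace_dim n V = n - k" "k \<le> n"
    by auto
  obtain S and c :: "nat \<Rightarrow> nat \<Rightarrow> int" where S: "S \<subseteq> {..<n}" "card S = k"
    and c: "\<And>i. i \<in> S \<Longrightarrow> odd (c i i)" "\<And>i j. i \<in> S \<Longrightarrow> j \<in> S \<Longrightarrow> i \<noteq> j \<Longrightarrow> c i j = 0"
    and ker: "V = {x \<in> carrier_vec n. \<forall>i\<in>S. (\<Sum>j<n. of_int (c i j) * vec_index x j) = 0}"
    using subspace_eq_integer_kernel[OF V] by blast
  show "(SUP t\<in>carrier_vec n. measure_pmf.prob (mu_vec (1/2) n) {x. x + t \<in> V})
      \<le> (7/8) ^ k * measure_pmf.prob (mu_vec p n) V"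
  proof (rule cSUP_least)
    show "carrier_vec n \<noteq> ({} :: rat Matrix.vec set)"
      using zero_carrier_vec by blast
  next
    fix t :: "rat Matrix.vec" assume t: "t \<in> carrier_vec n"
    \<comment> \<open>Rounding is harmless: whenever \<open>x + t\<close> lies in \<open>V\<close>
      for an integral \<open>x\<close>, the sum is an integer and the floor is exact. For other
      translates the event has probability 0, and any right-hand side bounds it.\<close>
    define v where "v i = \<lfloor>- (\<Sum>j<n. of_int (c i j) * vec_index t j)\<rfloor>" for i
    have "measure_pmf.prob (mu_vec (1/2) n) {x. x + t \<in> V} \<le>
        measure_pmf.prob (Pi_pmf {..<n} 0 (\<lambda>_. mu (1/2)))
          {x. \<forall>i\<in>S. (\<Sum>j<n. of_int (c i j) * x j) = of_int (v i)}"
      unfolding mu_vec_def measure_map_pmf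
    proof (intro measure_pmf.finite_measure_mono_AE AE_pmfI impI)
      fix x assume "x \<in> set_pmf (Pi_pmf {..<n} 0 (\<lambda>_. mu (1/2)))"
      then obtain z :: "nat \<Rightarrow> int" where z: "x = (\<lambda>j. of_int (z j))"
        by (rule set_Pi_pmf_mu_integral[rotated 3]) simp_all
      assume "x \<in> Matrix.vec n -` {x. x + t \<in> V}"
      then have eq: "(\<Sum>j<n. of_int (c i j) * vec_index (Matrix.vec n x + t) j) = 0" if "i \<in> S" for i
        using that unfolding ker by simp
      have "(\<Sum>j<n. of_int (c i j) * x j) = of_int (v i)" if i: "i \<in> S" for i
      proof -
        have "(\<Sum>j<n. of_int (c i j) * vec_index (Matrix.vec n x + t) j) =
            (\<Sum>j<n. of_int (c i j) * x j) + (\<Sum>j<n. of_int (c i j) * vec_index t j)"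
          unfolding sum.distrib[symmetric] using t by (intro sum.cong) (auto simp: distrib_left)
        then have *: "(\<Sum>j<n. of_int (c i j) * x j) = - (\<Sum>j<n. of_int (c i j) * vec_index t j)"
          using eq[OF i] by simp
        have "(\<Sum>j<n. of_int (c i j) * x j) = of_int (\<Sum>j<n. c i j * z j)"
          by (simp add: z)
        then show ?thesis
          unfolding v_def *[symmetric] by (simp only: floor_of_int)
      qed
      then show "x \<in> {x. \<forall>i\<in>S. (\<Sum>j<n. of_int (c i j) * x j) = of_int (v i)}"
        by simp
    qed simp
    also have "\<dots> \<le> (7/8) ^ card S * measure_pmf.prob (Pi_pmf {..<n} 0 (\<lambda>_. mu p))
          {x. \<forall>i\<in>S. (\<Sum>j<n. of_int (c i j) * x j) = 0}"
      using S(1) c p by (intro prob_linear_system_le) auto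
    also have "measure_pmf.prob (Pi_pmf {..<n} 0 (\<lambda>_. mu p))
          {x. \<forall>i\<in>S. (\<Sum>j<n. of_int (c i j) * x j) = 0} = measure_pmf.prob (mu_vec p n) V"
      unfolding mu_vec_def measure_map_pmf
      by (intro arg_cong[where f = "measure_pmf.prob _"]) (auto simp: ker)
    finally show "measure_pmf.prob (mu_vec (1/2) n) {x. x + t \<in> V}
        \<le> (7/8) ^ k * measure_pmf.prob (mu_vec p n) V"
      unfolding S(2) .
  qed
qed simp_all

end
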